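(* Let $\mathcal{X}$ be a smooth $n$-dimensional manifold, $f,g_1,\dots,g_m$ smooth vector fields on $\mathcal{X}$, $h_1,\dots,h_m:\mathcal{X}\to\mathbb{R}$ smooth functions, and $\mathcal{U}\subset\mathbb{R}^m$ a nonempty open set. Let $g$ be the matrix with columns $g_1,\dots,g_m$ and $h=(h_1,\dots,h_m)^T$. Let $K$ be a smooth Lagrangian subbundle of $T\mathcal{X}\oplus T^*\mathcal{X}$ such that for every $x\in\mathcal{X}$ the projection of $K(x)\subset T_x\mathcal{X}\times T_x^*\mathcal{X}$ on $T_x\mathcal{X}$ is all of $T_x\mathcal{X}$. In any local coordinates $x=(x_1,\dots,x_n)$ for $\mathcal{X}$, let $\Pi(x)=(\pi_{ij}(x))$ be the symmetric $n\times n$ matrix for which $K(x)=\{(\delta x,p)\mid p=\Pi(x)\delta x\}$. Then $K$ is invariant with respect to the differential Hamiltonian system on $T\mathcal{X}\oplus T^*\mathcal{X}$ if and only if in any such local coordinates $$\Big(\frac{\partial f}{\partial x}\Big)^T(x)\Pi(x)+\Pi(x)\frac{\partial f}{\partial x}(x)-\Pi(x)g(x)g^T(x)\Pi(x)+\Big(\frac{\partial h}{\partial x}\Big)^T(x)\frac{\partial h}{\partial x}(x)+\frac{\partial \Pi}{\partial x}(x)f(x)=0$$ and $$\Big(\frac{\partial g_j}{\partial x}\Big)^T(x)\Pi(x)+\Pi(x)\frac{\partial g_j}{\partial x}(x)+\frac{\partial \Pi}{\partial x}(x)g_j(x)=0,\qquad j=1,\dots,m.$$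
   Context: All objects are smooth. $T\mathcal{X}\oplus T^*\mathcal{X}$ is the Whitney sum, with points $(x,\delta x,p)$, $\delta x\in T_x\mathcal{X}$, $p\in T^*_x\mathcal{X}$. A subbundle $K$ is a vector bundle over $\mathcal{X}$ with fiber $K(x)\subset T_x\mathcal{X}\times T_x^*\mathcal{X}$; it is Lagrangian if each $K(x)$ is a Lagrangian subspace of $T_x\mathcal{X}\times T_x^*\mathcal{X}$ with respect to the canonical symplectic form. If a Lagrangian $K(x)$ projects onto $T_x\mathcal{X}$, then in coordinates it is the graph $p=\Pi(x)\delta x$ of a unique symmetric matrix $\Pi(x)$. The associated submanifold is $\mathcal{K}=\{(x,\delta x,p)\mid(\delta x,p)\in K(x)\}$. The differential Hamiltonian system is the control system on $T\mathcal{X}\oplus T^*\mathcal{X}$ with inputs $u=(u_1,\dots,u_m)\in\mathcal{U}$ given in induced coordinates by $$\begin{aligned}\dot x&=f(x)+\sum_{j=1}^m u_jg_j(x),\\ \dot{\delta x}&=\tfrac{\partial f}{\partial x}(x)\delta x-g(x)g(x)^Tp+\sum_{j=1}^m u_j\tfrac{\partial g_j}{\partial x}(x)\delta x,\\ \dot p&=-\left(\tfrac{\partial f}{\partial x}(x)\right)^Tp-\left(\tfrac{\partial h}{\partial x}(x)\right)^T\tfrac{\partial h}{\partial x}(x)\delta x-\sum_{j=1}^m u_j\left(\tfrac{\partial g_j}{\partial x}(x)\right)^Tp\end{aligned}$$ (a well-defined, coordinate-independent family of vector fields). $K$ is invariant with respect to this system if, for every fixed $u\in\mathcal{U}$, the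 right-hand side vector field is tangent to $\mathcal{K}$ at all points of $\mathcal{K}$. Notation: for a vector field $X$, $\frac{\partial X}{\partial x}$ is its Jacobian matrix in the coordinates, and $\frac{\partial\Pi}{\partial x}(x)X(x)$ denotes the $n\times n$ matrix with $(i,j)$ entry $\sum_{k}\frac{\partial\pi_{ij}}{\partial x_k}(x)X_k(x)$. *)

theory Defs
  imports "HOL-Analysis.Analysis" "HOL-Library.Function_Algebras"
begin

text \<open>Pointwise real vector space structure on functions, so that \<^const>\<open>subspace\<close>, \<^const>\<open>span\<close>
  and \<^const>\<open>independent\<close> apply to the tangent and cotangent vectors below.\<close>

instantiation "fun" :: (type, real_vector) real_vector
begin

definition scaleR_fun :: "real \<Rightarrow> ('a \<Rightarrow> 'b) \<Rightarrow> 'a \<Rightarrow> 'b"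
  where "scaleR_fun r f = (\<lambda>x. r *\<^sub>R f x)"

instance
  by standard (simp_all add: scaleR_fun_def fun_eq_iff algebra_simps)

end


section \<open>Smooth maps between Euclidean spaces\<close>

primrec Ck_on :: "nat \<Rightarrow> 'a::real_normed_vector set \<Rightarrow> ('a \<Rightarrow> 'b::real_normed_vector) \<Rightarrow> bool" where
  "Ck_on 0 S f \<longleftrightarrow> continuous_on S f"
| "Ck_on (Suc k) S f \<longleftrightarrow>
     (\<forall>x\<in>S. f differentiable (at x)) \<and> (\<forall>v. Ck_on k S (\<lambda>x. frechet_derivative f (at x) v))"

text \<open>Only used for open \<open>S\<close> in finite-dimensional spaces; hence derivatives are taken
  with respect to \<^term>\<open>at x\<close> and directional derivatives suffice.\<close>

definition smooth_on :: "'a::real_normed_vector set \<Rightarrow> ('a \<Rightarrow> 'b::real_normed_vector) \<Rightarrow> bool"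
  where "smooth_on S f \<longleftrightarrow> (\<forall>k. Ck_on k S f)"


section \<open>Smooth manifolds\<close>

text \<open>A chart is a pair of a domain and a coordinate map; the values of the coordinate map
  outside of the domain are irrelevant.\<close>

type_synonym ('a, 'n) chart = "'a set \<times> ('a \<Rightarrow> real^'n)"

definition chart_on :: "'a topology \<Rightarrow> ('a, 'n::finite) chart \<Rightarrow> bool" where
  "chart_on X c \<longleftrightarrow> openin X (fst c) \<and> open (snd c ` fst c) \<and>
     homeomorphic_map (subtopology X (fst c)) (top_of_set (snd c ` fst c)) (snd c)"

definition chart_inv :: "('a, 'n) chart \<Rightarrow> real^'n \<Rightarrow> 'a"
  where "chart_inv c = inv_into (fst c) (snd c)"

definition transition :: "('a, 'n) chart \<Rightarrow> ('a, 'n) chart \<Rightarrow> real^'n \<Rightarrow> real^'n"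
  where "transition c d = snd d \<circ> chart_inv c"

definition smooth_compatible :: "('a, 'n::finite) chart \<Rightarrow> ('a, 'n) chart \<Rightarrow> bool" where
  "smooth_compatible c d \<longleftrightarrow>
     smooth_on (snd c ` (fst c \<inter> fst d)) (transition c d) \<and>
     smooth_on (snd d ` (fst c \<inter> fst d)) (transition d c)"

text \<open>The atlas \<open>A\<close> is maximal, so ``any local coordinates'' means any \<open>c \<in> A\<close>.\<close>

definition smooth_manifold :: "'a topology \<Rightarrow> ('a, 'n::finite) chart set \<Rightarrow> bool" where
  "smooth_manifold X A \<longleftrightarrow>
     Hausdorff_space X \<and> second_countable X \<and>
     (\<forall>c\<in>A. chart_on X c) \<and>
     (\<Union>c\<in>A. fst c) = topspace X \<and>
     (\<forall>c\<in>A. \<forall>d\<in>A. smooth_compatible c d) \<and>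
     (\<forall>c. chart_on X c \<and> (\<forall>d\<in>A. smooth_compatible c d) \<longrightarrow> c \<in> A)"

definition charts_at :: "('a, 'n) chart set \<Rightarrow> 'a \<Rightarrow> ('a, 'n) chart set"
  where "charts_at A x = {c\<in>A. x \<in> fst c}"


section \<open>Tangent and cotangent vectors\<close>

text \<open>A tangent vector at \<open>x\<close> is a family of components, one column for every chart around \<open>x\<close>,
  that transforms with the Jacobian of the coordinate changes (and is 0 on all other charts).
  A cotangent vector is a linear functional on the tangent space (and is 0 outside of it).\<close>

type_synonym ('a, 'n) tvec = "('a, 'n) chart \<Rightarrow> real^'n"
type_synonym ('a, 'n) covec = "('a, 'n) tvec \<Rightarrow> real"

definition tangent_space :: "('a, 'n::finite) chart set \<Rightarrow> 'a \<Rightarrow> ('a, 'n) tvec set" where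
  "tangent_space A x =
     {v. (\<forall>c\<in>charts_at A x. \<forall>d\<in>charts_at A x.
            v d = jacobian (transition c d) (at (snd c x)) *v v c) \<and>
         (\<forall>c. c \<notin> charts_at A x \<longrightarrow> v c = 0)}"

definition cotangent_space :: "('a, 'n::finite) chart set \<Rightarrow> 'a \<Rightarrow> ('a, 'n) covec set" where
  "cotangent_space A x =
     {p. (\<forall>v\<in>tangent_space A x. \<forall>w\<in>tangent_space A x. p (v + w) = p v + p w) \<and>
         (\<forall>r. \<forall>v\<in>tangent_space A x. p (r *\<^sub>R v) = r * p v) \<and>
         (\<forall>v. v \<notin> tangent_space A x \<longrightarrow> p v = 0)}"

text \<open>The tangent vector at \<open>x\<close> with components \<open>w\<close> in the chart \<open>c\<close>.\<close>

definition tvec_of :: "('a, 'n::finite) chart set \<Rightarrow> ('a, 'n) chart \<Rightarrow> 'a \<Rightarrow> real^'n \<Rightarrow> ('a, 'n) tvec" where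
  "tvec_of A c x w =
     (\<lambda>d. if d \<in> charts_at A x then jacobian (transition c d) (at (snd c x)) *v w else 0)"

text \<open>Components \<open>p(\<partial>/\<partial>x\<^sub>i)\<close> of a cotangent vector in the chart \<open>c\<close>.\<close>

definition covec_coords :: "('a, 'n::finite) chart set \<Rightarrow> ('a, 'n) chart \<Rightarrow> 'a \<Rightarrow> ('a, 'n) covec \<Rightarrow> real^'n" where
  "covec_coords A c x p = (\<chi> i. p (tvec_of A c x (axis i 1)))"

text \<open>Fiber and total space of the Whitney sum, and its induced coordinates \<open>(x, \<delta>x, p)\<close>.\<close>

definition whitney_fiber :: "('a, 'n::finite) chart set \<Rightarrow> 'a \<Rightarrow> (('a, 'n) tvec \<times> ('a, 'n) covec) set"
  where "whitney_fiber A x = tangent_space A x \<times> cotangent_space A x"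

definition fiber_coords ::
  "('a, 'n::finite) chart set \<Rightarrow> ('a, 'n) chart \<Rightarrow> 'a \<Rightarrow> ('a, 'n) tvec \<times> ('a, 'n) covec \<Rightarrow> (real^'n) \<times> (real^'n)"
  where "fiber_coords A c x vp = (fst vp c, covec_coords A c x (snd vp))"

definition induced_coords ::
  "('a, 'n::finite) chart set \<Rightarrow> ('a, 'n) chart \<Rightarrow> 'a \<times> ('a, 'n) tvec \<times> ('a, 'n) covec
    \<Rightarrow> (real^'n) \<times> (real^'n) \<times> (real^'n)"
  where "induced_coords A c z = (snd c (fst z), fiber_coords A c (fst z) (snd z))"


section \<open>Vector fields and functions\<close>

definition vf_rep :: "('a, 'n) chart \<Rightarrow> ('a \<Rightarrow> ('a, 'n) tvec) \<Rightarrow> real^'n \<Rightarrow> real^'n"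
  where "vf_rep c f = (\<lambda>z. f (chart_inv c z) c)"

definition smooth_vector_field :: "'a topology \<Rightarrow> ('a, 'n::finite) chart set \<Rightarrow> ('a \<Rightarrow> ('a, 'n) tvec) \<Rightarrow> bool" where
  "smooth_vector_field X A f \<longleftrightarrow>
     (\<forall>x\<in>topspace X. f x \<in> tangent_space A x) \<and>
     (\<forall>c\<in>A. smooth_on (snd c ` fst c) (vf_rep c f))"

definition smooth_function :: "('a, 'n::finite) chart set \<Rightarrow> ('a \<Rightarrow> real) \<Rightarrow> bool" where
  "smooth_function A h \<longleftrightarrow> (\<forall>c\<in>A. smooth_on (snd c ` fst c) (h \<circ> chart_inv c))"

definition input_matrix_rep :: "('a, 'n::finite) chart \<Rightarrow> ('m::finite \<Rightarrow> 'a \<Rightarrow> ('a, 'n) tvec) \<Rightarrow> real^'n \<Rightarrow> real^'m^'n"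
  where "input_matrix_rep c g z = (\<chi> i j. vf_rep c (g j) z $ i)"

definition output_rep :: "('a, 'n::finite) chart \<Rightarrow> ('m::finite \<Rightarrow> 'a \<Rightarrow> real) \<Rightarrow> real^'n \<Rightarrow> real^'m"
  where "output_rep c h z = (\<chi> j. h j (chart_inv c z))"


section \<open>Lagrangian subbundles\<close>

definition canonical_form :: "('a, 'n) tvec \<times> ('a, 'n) covec \<Rightarrow> ('a, 'n) tvec \<times> ('a, 'n) covec \<Rightarrow> real"
  where "canonical_form z w = snd w (fst z) - snd z (fst w)"

definition lagrangian_subspace ::
  "('a, 'n::finite) chart set \<Rightarrow> 'a \<Rightarrow> (('a, 'n) tvec \<times> ('a, 'n) covec) set \<Rightarrow> bool" where
  "lagrangian_subspace A x L \<longleftrightarrow>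
     subspace L \<and> L \<subseteq> whitney_fiber A x \<and>
     L = {z \<in> whitney_fiber A x. \<forall>w\<in>L. canonical_form z w = 0}"

text \<open>Smoothness of a subbundle: near every point there is a frame of smooth local sections.\<close>

definition smooth_local_section ::
  "('a, 'n::finite) chart set \<Rightarrow> 'a set \<Rightarrow> ('a \<Rightarrow> ('a, 'n) tvec \<times> ('a, 'n) covec) \<Rightarrow> bool" where
  "smooth_local_section A W s \<longleftrightarrow>
     (\<forall>x\<in>W. s x \<in> whitney_fiber A x) \<and>
     (\<forall>c\<in>A. smooth_on (snd c ` (fst c \<inter> W))
               (\<lambda>z. fiber_coords A c (chart_inv c z) (s (chart_inv c z))))"

definition smooth_subbundle ::
  "'a topology \<Rightarrow> ('a, 'n::finite) chart set \<Rightarrow> ('a \<Rightarrow> (('a, 'n) tvec \<times> ('a, 'n) covec) set) \<Rightarrow> bool" where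
  "smooth_subbundle X A K \<longleftrightarrow>
     (\<exists>r::nat. \<forall>x0\<in>topspace X. \<exists>W s. openin X W \<and> x0 \<in> W \<and>
        (\<forall>i<r. smooth_local_section A W (s i)) \<and>
        (\<forall>x\<in>W. inj_on (\<lambda>i. s i x) {..<r} \<and>
               independent ((\<lambda>i. s i x) ` {..<r}) \<and>
               span ((\<lambda>i. s i x) ` {..<r}) = K x))"

definition lagrangian_subbundle ::
  "'a topology \<Rightarrow> ('a, 'n::finite) chart set \<Rightarrow> ('a \<Rightarrow> (('a, 'n) tvec \<times> ('a, 'n) covec) set) \<Rightarrow> bool" where
  "lagrangian_subbundle X A K \<longleftrightarrow>
     smooth_subbundle X A K \<and> (\<forall>x\<in>topspace X. lagrangian_subspace A x (K x))"

text \<open>The matrix \<open>\<Pi>\<close> in the chart \<open>c\<close>, as a function of the coordinates \<open>z\<close>.\<close>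

definition graph_matrix ::
  "('a, 'n::finite) chart set \<Rightarrow> ('a \<Rightarrow> (('a, 'n) tvec \<times> ('a, 'n) covec) set) \<Rightarrow> ('a, 'n) chart
    \<Rightarrow> real^'n \<Rightarrow> real^'n^'n" where
  "graph_matrix A K c z =
     (THE P. transpose P = P \<and>
        fiber_coords A c (chart_inv c z) ` K (chart_inv c z) = {(\<delta>x, p). p = P *v \<delta>x})"

definition matrix_derivative_along :: "(real^'n \<Rightarrow> real^'n^'n) \<Rightarrow> real^'n \<Rightarrow> real^'n::finite \<Rightarrow> real^'n^'n" where
  "matrix_derivative_along P z v =
     (\<chi> i j. \<Sum>k\<in>UNIV. frechet_derivative (\<lambda>y. P y $ i $ j) (at z) (axis k 1) * v $ k)"


section \<open>The differential Hamiltonian system and invariance\<close>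

text \<open>Right-hand side of the system in the coordinates induced by \<open>c\<close>, at the point with
  coordinates \<open>(z, \<delta>x, p)\<close>.\<close>

definition diff_hamiltonian_rhs ::
  "('a, 'n::finite) chart \<Rightarrow> ('a \<Rightarrow> ('a, 'n) tvec) \<Rightarrow> ('m::finite \<Rightarrow> 'a \<Rightarrow> ('a, 'n) tvec) \<Rightarrow> ('m \<Rightarrow> 'a \<Rightarrow> real)
    \<Rightarrow> real^'m \<Rightarrow> (real^'n) \<times> (real^'n) \<times> (real^'n) \<Rightarrow> (real^'n) \<times> (real^'n) \<times> (real^'n)" where
  "diff_hamiltonian_rhs c f g h u = (\<lambda>(z, \<delta>x, p).
     let F = vf_rep c f; G = (\<lambda>j. vf_rep c (g j)); gm = input_matrix_rep c g z; H = output_rep c h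
     in (F z + (\<Sum>j\<in>UNIV. u $ j *\<^sub>R G j z),
         jacobian F (at z) *v \<delta>x - (gm ** transpose gm) *v p
           + (\<Sum>j\<in>UNIV. u $ j *\<^sub>R (jacobian (G j) (at z) *v \<delta>x)),
         - (transpose (jacobian F (at z)) *v p)
           - (transpose (jacobian H (at z)) ** jacobian H (at z)) *v \<delta>x
           - (\<Sum>j\<in>UNIV. u $ j *\<^sub>R (transpose (jacobian (G j) (at z)) *v p))))"

text \<open>Velocities at \<open>z\<close> of smooth curves in \<open>S\<close>; this is the tangent space at \<open>z\<close> if \<open>S\<close> is an
  embedded submanifold of a Euclidean space.\<close>

definition tangent_vectors :: "'e::real_normed_vector set \<Rightarrow> 'e \<Rightarrow> 'e set" where
  "tangent_vectors S z =
     {w. \<exists>\<gamma> \<epsilon>. 0 < \<epsilon> \<and> smooth_on {-\<epsilon><..<\<epsilon>} \<gamma> \<and> \<gamma> ` {-\<epsilon><..<\<epsilon>} \<subseteq> S \<and>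
            \<gamma> 0 = z \<and> (\<gamma> has_vector_derivative w) (at (0::real))}"

definition assoc_submanifold ::
  "'a topology \<Rightarrow> ('a \<Rightarrow> (('a, 'n) tvec \<times> ('a, 'n) covec) set) \<Rightarrow> ('a \<times> ('a, 'n) tvec \<times> ('a, 'n) covec) set"
  where "assoc_submanifold X K = Sigma (topspace X) K"

text \<open>Tangency is expressed in induced coordinates; since the system is coordinate independent
  it does not matter whether this is required in one or in all charts around a point.\<close>

definition invariant_subbundle ::
  "'a topology \<Rightarrow> ('a, 'n::finite) chart set \<Rightarrow> ('a \<Rightarrow> ('a, 'n) tvec) \<Rightarrow> ('m::finite \<Rightarrow> 'a \<Rightarrow> ('a, 'n) tvec)
    \<Rightarrow> ('m \<Rightarrow> 'a \<Rightarrow> real) \<Rightarrow> (real^'m) set \<Rightarrow> ('a \<Rightarrow> (('a, 'n) tvec \<times> ('a, 'n) covec) set) \<Rightarrow> bool" where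
  "invariant_subbundle X A f g h U K \<longleftrightarrow>
     (\<forall>u\<in>U. \<forall>z\<in>assoc_submanifold X K. \<forall>c\<in>charts_at A (fst z).
        diff_hamiltonian_rhs c f g h u (induced_coords A c z)
          \<in> tangent_vectors (induced_coords A c ` {y\<in>assoc_submanifold X K. fst y \<in> fst c})
              (induced_coords A c z))"

end

theory Submission
  imports Defs
begin

text \<open>In induced coordinates the submanifold of \<open>K\<close> is the graph \<open>p = \<Pi>(z) \<delta>x\<close>, whose tangent
  vectors at \<open>(z, \<delta>x, \<Pi>(z) \<delta>x)\<close> are the triples \<open>(a, b, e)\<close> with
  \<open>e = (\<partial>\<Pi>(z) a) \<delta>x + \<Pi>(z) b\<close>. Inserting the right-hand side of the system turns tangency into
  \<open>(M\<^sub>0 + \<Sum>\<^sub>j u\<^sub>j M\<^sub>j) \<delta>x = 0\<close>, where \<open>M\<^sub>0\<close> and \<open>M\<^sub>j\<close> are the left-hand sides of the Riccati and the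
  Lyapunov type equations. This holds for all \<open>\<delta>x\<close> and all \<open>u\<close> in a nonempty open set
  iff all these matrices vanish. The graph matrix \<open>\<Pi>\<close> exists since a Lagrangian subspace that projects
  onto the tangent space contains no nonzero vertical vector, and it is smooth since Cramer's rule
  expresses it rationally in the components of a smooth frame of \<open>K\<close>.\<close>

section \<open>Calculus of smooth maps\<close>

text \<open>Derivatives are taken in the whole space, so agreement on \<open>S\<close> passes to
  them because \<open>S\<close> is open. The functions vary in the induction, which proceeds through
  directional derivatives.\<close>

lemma Ck_on_cong:
  assumes "open S" "\<And>x. x \<in> S \<Longrightarrow> f x = g x" "Ck_on k S f"
  shows "Ck_on k S g"
  using assms(2,3)
proof (induction k arbitrary: f g)
  case 0
  then show ?case using continuous_on_cong[of S S f g] by simp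
next
  case (Suc k)
  have D: "(g has_derivative frechet_derivative f (at x)) (at x)" if "x \<in> S" for x
  proof (rule has_derivative_transform_within_open[OF _ assms(1) that Suc.prems(1)])
    show "(f has_derivative frechet_derivative f (at x)) (at x)"
      using Suc.prems(2) that by (simp flip: frechet_derivative_works)
  qed
  have "Ck_on k S (\<lambda>x. frechet_derivative g (at x) v)" for v
  proof (rule Suc.IH)
    show "Ck_on k S (\<lambda>x. frechet_derivative f (at x) v)"
      using Suc.prems(2) by simp
    show "frechet_derivative f (at x) v = frechet_derivative g (at x) v" if "x \<in> S" for x
      using frechet_derivative_at[OF D[OF that]] by simp
  qed
  moreover have "g differentiable (at x)" if "x \<in> S" for x
    using D[OF that] by (rule differentiableI)
  ultimately show ?case by simp
qed

text \<open>Uniqueness of the derivative lets an explicit formula \<open>f'\<close> replace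
  \<open>frechet_derivative\<close>. The closure properties below are proved through this
  rule.\<close>

lemma Ck_on_SucI:
  assumes "open S" "\<And>x. x \<in> S \<Longrightarrow> (f has_derivative f' x) (at x)"
    and "\<And>v. Ck_on k S (\<lambda>x. f' x v)"
  shows "Ck_on (Suc k) S f"
proof -
  have "Ck_on k S (\<lambda>x. frechet_derivative f (at x) v)" for v
    by (rule Ck_on_cong[OF assms(1) _ assms(3)[of v]]) (simp add: frechet_derivative_at[OF assms(2), symmetric])
  then show ?thesis using assms(2) by (auto intro: differentiableI)
qed

lemma Ck_on_Suc_has_derivative:
  assumes "Ck_on (Suc k) S f" "x \<in> S"
  shows "(f has_derivative frechet_derivative f (at x)) (at x)"
  using assms by (simp flip: frechet_derivative_works)

lemma Ck_on_Suc_imp: "Ck_on (Suc k) S f \<Longrightarrow> Ck_on k S f"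
proof (induction k arbitrary: f)
  case 0
  then have "isCont f x" if "x \<in> S" for x
    using that differentiable_imp_continuous_within by (metis Ck_on.simps(2))
  then show ?case by (simp add: continuous_at_imp_continuous_on)
next
  case (Suc k)
  then show ?case by (metis Ck_on.simps(2))
qed

lemma Ck_on_const: "open S \<Longrightarrow> Ck_on k S (\<lambda>x. c)"
proof (induction k arbitrary: c)
  case (Suc k)
  then show ?case by (intro Ck_on_SucI[where f' = "\<lambda>x v. 0"]) auto
qed auto

lemma Ck_on_bounded_linear:
  assumes "bounded_linear L" "open S" "Ck_on k S f"
  shows "Ck_on k S (\<lambda>x. L (f x))"
  using assms(3)
proof (induction k arbitrary: f)
  case 0
  then show ?case using assms by (auto intro: bounded_linear.continuous_on)
next
  case (Suc k)
  show ?case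
  proof (rule Ck_on_SucI[OF assms(2)
        bounded_linear.has_derivative[OF assms(1) Ck_on_Suc_has_derivative[OF Suc.prems]]])
    show "Ck_on k S (\<lambda>x. L (frechet_derivative f (at x) v))" for v
      using Suc by simp
  qed
qed

lemma Ck_on_add:
  assumes "open S" "Ck_on k S f" "Ck_on k S g"
  shows "Ck_on k S (\<lambda>x. f x + g x)"
  using assms(2,3)
proof (induction k arbitrary: f g)
  case 0
  then show ?case by (auto intro: continuous_on_add)
next
  case (Suc k)
  show ?case
  proof (rule Ck_on_SucI[OF assms(1) has_derivative_add])
    show "Ck_on k S (\<lambda>x. frechet_derivative f (at x) v + frechet_derivative g (at x) v)" for v
      using Suc by simp
  qed (fact Ck_on_Suc_has_derivative[OF Suc.prems(1)] Ck_on_Suc_has_derivative[OF Suc.prems(2)])+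
qed

lemma Ck_on_sum:
  assumes "open S" "\<And>i. i \<in> I \<Longrightarrow> Ck_on k S (f i)"
  shows "Ck_on k S (\<lambda>x. \<Sum>i\<in>I. f i x)"
  using assms(2)
  by (induction I rule: infinite_finite_induct) (auto intro: Ck_on_add Ck_on_const assms(1))

text \<open>Each term of the product rule keeps one factor undifferentiated. Lowering its order by
  \<open>Ck_on_Suc_imp\<close> makes the induction hypothesis applicable.\<close>

lemma Ck_on_bounded_bilinear:
  assumes "bounded_bilinear B" "open S" "Ck_on k S f" "Ck_on k S g"
  shows "Ck_on k S (\<lambda>x. B (f x) (g x))"
  using assms(3,4)
proof (induction k arbitrary: f g)
  case 0
  then show ?case using assms by (auto intro: bounded_bilinear.continuous_on)
next
  case (Suc k)
  show ?case
  proof (rule Ck_on_SucI[OF assms(2) bounded_bilinear.FDERIV[OF assms(1)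
          Ck_on_Suc_has_derivative[OF Suc.prems(1)] Ck_on_Suc_has_derivative[OF Suc.prems(2)]]])
    show "Ck_on k S (\<lambda>x. B (f x) (frechet_derivative g (at x) v)
      + B (frechet_derivative f (at x) v) (g x))" for v
      using Suc Ck_on_Suc_imp[OF Suc.prems(1)] Ck_on_Suc_imp[OF Suc.prems(2)]
      by (intro Ck_on_add[OF assms(2)]) auto
  qed
qed

lemmas Ck_on_mult = Ck_on_bounded_bilinear[OF bounded_bilinear_mult]

lemma Ck_on_prod:
  fixes f :: "'i \<Rightarrow> 'a::real_normed_vector \<Rightarrow> real"
  assumes "open S" "\<And>i. i \<in> I \<Longrightarrow> Ck_on k S (f i)"
  shows "Ck_on k S (\<lambda>x. \<Prod>i\<in>I. f i x)"
  using assms(2)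
  by (induction I rule: infinite_finite_induct) (auto intro: Ck_on_mult Ck_on_const assms(1))

text \<open>The derivative of \<open>1/f\<close> is a product of \<open>f'\<close> with two copies
  of \<open>1/f\<close>, so the induction hypothesis is applied to the same function
  \<open>f\<close>.\<close>

lemma Ck_on_inverse:
  fixes f :: "'a::real_normed_vector \<Rightarrow> real"
  assumes "open S" "Ck_on k S f" "\<And>x. x \<in> S \<Longrightarrow> f x \<noteq> 0"
  shows "Ck_on k S (\<lambda>x. inverse (f x))"
  using assms(2)
proof (induction k)
  case 0
  then show ?case using assms by (auto intro: continuous_on_inverse)
next
  case (Suc k)
  show ?case
  proof (rule Ck_on_SucI[OF assms(1)])
    show "((\<lambda>x. inverse (f x)) has_derivative
      (\<lambda>v. (- 1) * (inverse (f x) * frechet_derivative f (at x) v * inverse (f x)))) (at x)"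
      if "x \<in> S" for x
      using Deriv.has_derivative_inverse[OF assms(3)[OF that] Ck_on_Suc_has_derivative[OF Suc.prems that]]
      by simp
    show "Ck_on k S (\<lambda>x. (- 1) * (inverse (f x) * frechet_derivative f (at x) v * inverse (f x)))" for v
      using Suc Ck_on_Suc_imp[OF Suc.prems]
      by (intro Ck_on_mult Ck_on_const assms(1)) auto
  qed
qed

text \<open>A vector is the sum of its components, each put back in place by the linear map
  \<open>axis i\<close>.\<close>

lemma Ck_on_vec:
  fixes f :: "'a::real_normed_vector \<Rightarrow> 'b::euclidean_space^'n::finite"
  assumes "open S" "\<And>i. Ck_on k S (\<lambda>x. f x $ i)"
  shows "Ck_on k S f"
proof -
  have "linear (axis i :: 'b \<Rightarrow> 'b^'n)" for i
    by (auto simp: linear_iff axis_def vec_eq_iff)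
  then have "Ck_on k S (\<lambda>x. axis i (f x $ i))" for i
    by (intro Ck_on_bounded_linear[of "axis i", OF _ assms]) (simp add: linear_conv_bounded_linear)
  then have "Ck_on k S (\<lambda>x. \<Sum>i\<in>UNIV. axis i (f x $ i))"
    by (intro Ck_on_sum assms(1))
  moreover have "(\<Sum>i\<in>UNIV. axis i (f x $ i)) = f x" for x
    by (simp add: vec_eq_iff axis_def if_distrib [where f = "\<lambda>v. v $ _"] cong: if_cong)
  ultimately show ?thesis by simp
qed

lemma Ck_on_vec_nth:
  "open S \<Longrightarrow> Ck_on k S f \<Longrightarrow> Ck_on k S (\<lambda>x. f x $ i)"
  by (rule Ck_on_bounded_linear[OF bounded_linear_vec_nth])

lemma Ck_on_Pair:
  assumes "open S" "Ck_on k S f" "Ck_on k S g"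
  shows "Ck_on k S (\<lambda>x. (f x, g x))"
proof -
  have "Ck_on k S (\<lambda>x. (f x, 0) + (0, g x))"
    by (intro Ck_on_add assms Ck_on_bounded_linear[of "\<lambda>y. (y, 0)"]
        Ck_on_bounded_linear[of "Pair 0"] bounded_linear_Pair bounded_linear_ident bounded_linear_zero)
  then show ?thesis by simp
qed

lemma Ck_on_det:
  fixes M :: "'a::real_normed_vector \<Rightarrow> real^'n::finite^'n"
  assumes "open S" "\<And>i j. Ck_on k S (\<lambda>x. M x $ i $ j)"
  shows "Ck_on k S (\<lambda>x. det (M x))"
  unfolding det_def by (intro Ck_on_sum Ck_on_mult Ck_on_const Ck_on_prod assms)

text \<open>This is the only instance of the chain rule for higher orders in use. The velocity of
  the curve is the constant \<open>a\<close>, so differentiation just replaces \<open>f\<close> by a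
  directional derivative of \<open>f\<close> along the same curve.\<close>

lemma Ck_on_affine_curve:
  fixes z a :: "'a::real_normed_vector"
  assumes "open I" "Ck_on k S f" "(\<lambda>t. z + t *\<^sub>R a) ` I \<subseteq> S"
  shows "Ck_on k I (\<lambda>t::real. f (z + t *\<^sub>R a))"
  using assms(2)
proof (induction k arbitrary: f)
  case 0
  then show ?case
    using assms by (auto intro!: continuous_on_compose2[of S f] continuous_intros)
next
  case (Suc k)
  show ?case
  proof (rule Ck_on_SucI[OF assms(1)])
    fix t assume "t \<in> I"
    then have "z + t *\<^sub>R a \<in> S" using assms by auto
    then show "((\<lambda>t. f (z + t *\<^sub>R a)) has_derivative
      (\<lambda>r. frechet_derivative f (at (z + t *\<^sub>R a)) (r *\<^sub>R a))) (at t)"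
      by (intro has_derivative_compose[OF _ Ck_on_Suc_has_derivative[OF Suc.prems]])
        (auto intro!: derivative_eq_intros)
  next
    show "Ck_on k I (\<lambda>t. frechet_derivative f (at (z + t *\<^sub>R a)) (r *\<^sub>R a))" for r
      using Suc by (intro Suc.IH) auto
  qed
qed

lemma bounded_bilinear_matrix_vector_mult:
  "bounded_bilinear ((*v) :: real^'n::finite^'m::finite \<Rightarrow> _)"
  by (intro bilinear_conv_bounded_bilinear[THEN iffD1])
    (auto simp: bilinear_def linear_iff matrix_vector_mult_add_rdistrib matrix_vector_right_distrib
      matrix_vector_mult_scaleR scaleR_matrix_vector_assoc)

lemma smooth_on_has_derivative:
  "smooth_on S f \<Longrightarrow> x \<in> S \<Longrightarrow> (f has_derivative frechet_derivative f (at x)) (at x)"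
  by (meson smooth_on_def Ck_on_Suc_has_derivative)

text \<open>Continuity and differentiability at a point depend only on a neighbourhood of
  it.\<close>

lemma Ck_on_local:
  assumes "\<And>x. x \<in> S \<Longrightarrow> \<exists>T. open T \<and> x \<in> T \<and> Ck_on k T f"
  shows "Ck_on k S f"
  using assms
proof (induction k arbitrary: f)
  case 0
  have "isCont f x" if "x \<in> S" for x
    using 0[OF that] by (auto simp: continuous_on_eq_continuous_at)
  then show ?case by (simp add: continuous_at_imp_continuous_on)
next
  case (Suc k)
  have "f differentiable (at x)" if "x \<in> S" for x
    using Suc.prems[OF that] by auto
  moreover have "Ck_on k S (\<lambda>x. frechet_derivative f (at x) v)" for v
    using Suc.prems by (intro Suc.IH) (metis Ck_on.simps(2))
  ultimately show ?case by simp
qed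

lemma smooth_on_fst_snd:
  assumes "open S" "smooth_on S f"
  shows "smooth_on S (\<lambda>x. fst (f x))" "smooth_on S (\<lambda>x. snd (f x))"
  using assms
  by (auto simp: smooth_on_def intro: Ck_on_bounded_linear[OF bounded_linear_fst]
      Ck_on_bounded_linear[OF bounded_linear_snd])

text \<open>Row \<open>i\<close> of \<open>P z\<close> solves the square linear system with rows
  \<open>\<sigma> b z\<close> and right-hand sides \<open>\<tau> b z $ i\<close>. The system is
  regular because the rows span, so Cramer's rule writes the entries of \<open>P\<close> as
  quotients of determinants of smooth functions.\<close>

lemma smooth_on_matrix_if_maps_spanning_sections:
  fixes P :: "'a::real_normed_vector \<Rightarrow> real^'n::finite^'n" and \<sigma> \<tau> :: "'n \<Rightarrow> 'a \<Rightarrow> real^'n"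
  assumes "open V" "\<And>b. smooth_on V (\<sigma> b)" "\<And>b. smooth_on V (\<tau> b)"
    and "\<And>z b. z \<in> V \<Longrightarrow> \<tau> b z = P z *v \<sigma> b z"
    and "\<And>z. z \<in> V \<Longrightarrow> span (range (\<lambda>b. \<sigma> b z)) = UNIV"
  shows "smooth_on V P"
proof -
  define S where "S z = (\<chi> b a. \<sigma> b z $ a)" for z
  have S_mult: "S z *v w = (\<chi> b. \<sigma> b z \<bullet> w)" for z w
    by (simp add: S_def matrix_vector_mult_def inner_vec_def)
  have det: "det (S z) \<noteq> 0" if "z \<in> V" for z
  proof -
    \<comment> \<open>A kernel vector is orthogonal to all rows, hence to their span, hence to
      itself.\<close>
    have "w = 0" if "S z *v w = 0" for w
    proof -
      have "orthogonal w (\<sigma> b z)" for b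
        using that by (simp add: S_mult vec_eq_iff orthogonal_def inner_commute)
      then have "orthogonal w w"
        using orthogonal_to_span[of w "range (\<lambda>b. \<sigma> b z)" w] assms(5)[OF \<open>z \<in> V\<close>] by auto
      then show "w = 0" by (simp add: orthogonal_self)
    qed
    then have "invertible (S z)"
      by (simp add: invertible_left_inverse matrix_left_invertible_ker)
    then show ?thesis by (simp add: invertible_det_nz)
  qed
  \<comment> \<open>Cramer's quotient for entry \<open>(i, j)\<close>: column \<open>j\<close> of
    \<open>S z\<close> is replaced by the right-hand side.\<close>
  let ?C = "\<lambda>z i j. det (\<chi> b a. if a = j then \<tau> b z $ i else S z $ b $ a) * inverse (det (S z))"
  have cramer_entry: "P z $ i $ j = ?C z i j" if "z \<in> V" for z i j
  proof -
    have "S z *v (P z $ i) = (\<chi> b. \<tau> b z $ i)"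
      by (simp add: S_mult assms(4)[OF that] matrix_vector_mul_component inner_commute)
    then have "P z $ i = (\<chi> k. det (\<chi> b a. if a = k then (\<chi> b. \<tau> b z $ i) $ b else S z $ b $ a) / det (S z))"
      using cramer[OF det[OF that]] by blast
    then show ?thesis by (simp add: divide_inverse cong: if_cong)
  qed
  have "Ck_on k V P" for k
  proof -
    have S: "Ck_on k V (\<lambda>z. S z $ b $ a)" for a b
      using assms(1,2) by (simp add: S_def smooth_on_def Ck_on_vec_nth)
    have T: "Ck_on k V (\<lambda>z. \<tau> b z $ i)" for i b
      using assms(1,3) by (simp add: smooth_on_def Ck_on_vec_nth)
    have "Ck_on k V (\<lambda>z. (\<chi> b a. if a = j then \<tau> b z $ i else S z $ b $ a) $ b' $ a')" for i j b' a'
      using S T by (cases "a' = j") simp_all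
    then have C: "Ck_on k V (\<lambda>z. ?C z i j)" for i j
      by (intro Ck_on_mult Ck_on_det Ck_on_inverse assms(1) det S)
    have "Ck_on k V (\<lambda>z. P z $ i $ j)" for i j
      by (rule Ck_on_cong[OF assms(1) _ C[where i = i and j = j]]) (simp add: cramer_entry)
    then show ?thesis
      by (intro Ck_on_vec assms(1))
  qed
  then show ?thesis by (simp add: smooth_on_def)
qed

section \<open>Tangent vectors of a graph\<close>

text \<open>Expanding \<open>v\<close> in the standard basis turns the sum of partial derivatives
  into the total derivative, which is linear in \<open>v\<close>.\<close>

lemma matrix_derivative_along_eq:
  fixes P :: "real^'n::finite \<Rightarrow> real^'n^'n"
  assumes "(P has_derivative P') (at z)"
  shows "matrix_derivative_along P z v = P' v"
proof -
  have lin: "linear P'" using assms has_derivative_linear by blast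
  have "frechet_derivative (\<lambda>y. P y $ i $ j) (at z) = (\<lambda>w. P' w $ i $ j)" for i j
    by (rule frechet_derivative_at[symmetric])
      (intro bounded_linear.has_derivative[OF bounded_linear_vec_nth] assms)
  moreover have "P' v = (\<Sum>k\<in>UNIV. v $ k *\<^sub>R P' (axis k 1))"
    by (subst basis_expansion[symmetric, of v])
       (simp add: linear_sum[OF lin] linear_cmul[OF lin] scalar_mult_eq_scaleR)
  ultimately show ?thesis
    by (simp add: matrix_derivative_along_def vec_eq_iff mult.commute)
qed

text \<open>The last component of a curve in the graph is determined by the other two, so the
  product rule gives its velocity. Conversely, an affine curve in the first two components lifts to
  the graph with any prescribed \<open>a\<close> and \<open>b\<close>.\<close>

lemma tangent_vectors_graph:
  fixes P :: "real^'n::finite \<Rightarrow> real^'n^'n"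
  assumes "open V" "smooth_on V P" "z \<in> V"
  shows "(a, b, e) \<in> tangent_vectors {(y, d, p). y \<in> V \<and> p = P y *v d} (z, d, P z *v d)
    \<longleftrightarrow> e = matrix_derivative_along P z a *v d + P z *v b"
proof -
  let ?S = "{(y, d, p). y \<in> V \<and> p = P y *v d}"
  let ?P' = "frechet_derivative P (at z)"
  have P': "(P has_derivative ?P') (at z)"
    using assms smooth_on_has_derivative by blast
  then have mda: "matrix_derivative_along P z a = ?P' a"
    by (rule matrix_derivative_along_eq)
  have scale: "?P' (r *\<^sub>R a) = r *\<^sub>R ?P' a" for r
    using P' has_derivative_linear linear_cmul by blast
  \<comment> \<open>The product rule for an arbitrary pair of curves through \<open>z\<close> and
    \<open>d\<close>; both directions of the equivalence rely on it.\<close>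
  have curve: "((\<lambda>t. P (x t) *v y t) has_vector_derivative ?P' a *v d + P z *v b) (at 0)"
    if "(x has_vector_derivative a) (at 0)" "(y has_vector_derivative b) (at 0)" "x 0 = z" "y 0 = d"
    for x y
  proof -
    have "((\<lambda>t. P (x t)) has_derivative (\<lambda>r. ?P' (r *\<^sub>R a))) (at 0)"
      using that P' by (intro has_derivative_compose[of x _ 0 UNIV P])
        (auto simp: has_vector_derivative_def)
    then have "((\<lambda>t. P (x t)) has_vector_derivative ?P' a) (at 0)"
      by (simp add: has_vector_derivative_def scale)
    then show ?thesis
      using bounded_bilinear.has_vector_derivative[OF bounded_bilinear_matrix_vector_mult _ that(2)]
        that(3,4) by (fastforce simp: add.commute)
  qed
  show ?thesis
  proof
    assume "(a, b, e) \<in> tangent_vectors ?S (z, d, P z *v d)"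
    then obtain \<gamma> \<epsilon> where e: "0 < \<epsilon>" "\<gamma> ` {-\<epsilon><..<\<epsilon>} \<subseteq> ?S" "\<gamma> 0 = (z, d, P z *v d)"
      "(\<gamma> has_vector_derivative (a, b, e)) (at 0)"
      by (auto simp: tangent_vectors_def)
    let ?x = "\<lambda>t. fst (\<gamma> t)" and ?y = "\<lambda>t. fst (snd (\<gamma> t))" and ?w = "\<lambda>t. snd (snd (\<gamma> t))"
    have d: "(?x has_vector_derivative a) (at 0)" "(?y has_vector_derivative b) (at 0)"
      "(?w has_vector_derivative e) (at 0)"
      using bounded_linear.has_vector_derivative[OF bounded_linear_fst e(4)]
        bounded_linear.has_vector_derivative[OF bounded_linear_compose[OF bounded_linear_fst bounded_linear_snd] e(4)]
        bounded_linear.has_vector_derivative[OF bounded_linear_compose[OF bounded_linear_snd bounded_linear_snd] e(4)]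
      by auto
    have "((\<lambda>t. P (?x t) *v ?y t) has_vector_derivative ?P' a *v d + P z *v b) (at 0)"
      using d e by (intro curve) auto
    then have "(?w has_vector_derivative ?P' a *v d + P z *v b) (at 0)"
    proof (rule has_vector_derivative_transform_within_open)
      show "P (?x t) *v ?y t = ?w t" if "t \<in> {-\<epsilon><..<\<epsilon>}" for t
        using e(2) that by (force simp: image_subset_iff case_prod_beta)
    qed (use e(1) in auto)
    then show "e = matrix_derivative_along P z a *v d + P z *v b"
      using vector_derivative_unique_at[OF d(3)] mda by simp
  next
    assume e: "e = matrix_derivative_along P z a *v d + P z *v b"
    let ?x = "\<lambda>t::real. z + t *\<^sub>R a" and ?y = "\<lambda>t::real. d + t *\<^sub>R b"
    let ?\<gamma> = "\<lambda>t. (?x t, ?y t, P (?x t) *v ?y t)"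
    \<comment> \<open>The curve must stay over \<open>V\<close>, which holds for small
      times.\<close>
    have "open (?x -` V)"
      by (intro open_vimage assms continuous_intros)
    moreover have "0 \<in> ?x -` V"
      using assms(3) by simp
    ultimately obtain \<epsilon> where eps: "\<epsilon> > 0" "ball 0 \<epsilon> \<subseteq> ?x -` V"
      by (rule openE)
    have I: "{-\<epsilon><..<\<epsilon>} = ball (0::real) \<epsilon>"
      by (auto simp: ball_def dist_real_def)
    have id: "Ck_on k {-\<epsilon><..<\<epsilon>} (\<lambda>t. t)" for k
    proof (cases k)
      case (Suc l)
      then show ?thesis
        by (auto intro!: Ck_on_SucI[where f' = "\<lambda>x v. v"] Ck_on_const)
    qed auto
    have "Ck_on k {-\<epsilon><..<\<epsilon>} (\<lambda>t. c + t *\<^sub>R s)" for k and c s :: "real^'n"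
      by (intro Ck_on_add Ck_on_const Ck_on_bounded_linear[OF bounded_linear_scaleR_left] id) auto
    moreover have "Ck_on k {-\<epsilon><..<\<epsilon>} (\<lambda>t. P (?x t))" for k
      using assms(2) eps I by (intro Ck_on_affine_curve[of _ _ V]) (auto simp: smooth_on_def)
    ultimately have "smooth_on {-\<epsilon><..<\<epsilon>} ?\<gamma>"
      unfolding smooth_on_def
      by (intro allI Ck_on_Pair Ck_on_bounded_bilinear[OF bounded_bilinear_matrix_vector_mult]) auto
    moreover have "?\<gamma> ` {-\<epsilon><..<\<epsilon>} \<subseteq> ?S"
      using eps I by auto
    moreover have "(?\<gamma> has_vector_derivative (a, b, e)) (at 0)"
    proof -
      have "(?x has_vector_derivative a) (at 0)" "(?y has_vector_derivative b) (at 0)"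
        by (auto intro!: derivative_eq_intros)
      then show ?thesis
        using e mda curve[of ?x ?y] by (intro has_vector_derivative_Pair) auto
    qed
    ultimately show "(a, b, e) \<in> tangent_vectors ?S (z, d, P z *v d)"
      unfolding tangent_vectors_def using eps(1) by (auto intro!: exI[of _ ?\<gamma>] exI[of _ \<epsilon>])
  qed
qed

section \<open>Charts, tangent and cotangent vectors\<close>

lemma inj_on_chart: "chart_on X c \<Longrightarrow> inj_on (snd c) (fst c)"
  unfolding chart_on_def
  by (metis homeomorphic_imp_injective_map openin_subset topspace_subtopology_subset)

lemma chart_inv_apply: "chart_on X c \<Longrightarrow> x \<in> fst c \<Longrightarrow> chart_inv c (snd c x) = x"
  by (simp add: chart_inv_def inj_on_chart inv_into_f_f)

text \<open>A chart is a homeomorphism onto its image, and that image is open in the Euclidean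
  space.\<close>

lemma open_chart_image:
  assumes "chart_on X c" "openin X W"
  shows "open (snd c ` (fst c \<inter> W))"
proof -
  have "openin (subtopology X (fst c)) (fst c \<inter> W)"
    using assms(2) by (simp add: openin_subtopology_Int2)
  then have "openin (top_of_set (snd c ` fst c)) (snd c ` (fst c \<inter> W))"
    using assms(1) homeomorphic_imp_open_map unfolding chart_on_def open_map_def by blast
  then show ?thesis
    using assms(1) openin_open_eq unfolding chart_on_def by blast
qed

lemma linear_tvec_of: "linear (tvec_of A c x)"
  by (auto simp: linear_iff tvec_of_def fun_eq_iff matrix_vector_right_distrib
      matrix_vector_mult_scaleR scaleR_fun_def)

lemma tangent_space_transform:
  assumes "v \<in> tangent_space A x" "c \<in> charts_at A x" "d \<in> charts_at A x"
  shows "v d = jacobian (transition c d) (at (snd c x)) *v v c"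
  using assms unfolding tangent_space_def by blast

lemma tangent_space_outside: "v \<in> tangent_space A x \<Longrightarrow> c \<notin> charts_at A x \<Longrightarrow> v c = 0"
  unfolding tangent_space_def by blast

lemma tangent_spaceI:
  assumes "\<And>c d. c \<in> charts_at A x \<Longrightarrow> d \<in> charts_at A x \<Longrightarrow>
      v d = jacobian (transition c d) (at (snd c x)) *v v c"
    and "\<And>c. c \<notin> charts_at A x \<Longrightarrow> v c = 0"
  shows "v \<in> tangent_space A x"
  using assms unfolding tangent_space_def by blast

lemma subspace_tangent_space: "subspace (tangent_space A x)"
proof (rule subspaceI)
  show "0 \<in> tangent_space A x"
    by (rule tangent_spaceI) simp_all
next
  fix v w assume v: "v \<in> tangent_space A x" and w: "w \<in> tangent_space A x"
  show "v + w \<in> tangent_space A x"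
    by (rule tangent_spaceI) (simp_all add: matrix_vector_right_distrib tangent_space_outside[OF v]
        tangent_space_outside[OF w]
        flip: tangent_space_transform[OF v] tangent_space_transform[OF w])
next
  fix r :: real and v assume v: "v \<in> tangent_space A x"
  show "r *\<^sub>R v \<in> tangent_space A x"
    by (rule tangent_spaceI) (simp_all add: scaleR_fun_def matrix_vector_mult_scaleR
        tangent_space_outside[OF v] flip: tangent_space_transform[OF v])
qed

lemma linear_fiber_coords: "linear (fiber_coords A c x)"
  by (auto simp: linear_iff fiber_coords_def covec_coords_def scaleR_fun_def vec_eq_iff)

lemma linear_fst_component: "linear (\<lambda>q. fst q c)"
  by (auto simp: linear_iff scaleR_fun_def)

context
  fixes X :: "'a topology" and A :: "('a, 'n::finite) chart set"
  assumes manifold: "smooth_manifold X A"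
begin

lemma chart_on_atlas: "c \<in> A \<Longrightarrow> chart_on X c"
  using manifold by (simp add: smooth_manifold_def)

lemma chart_on_charts_at: "c \<in> charts_at A x \<Longrightarrow> chart_on X c"
  by (simp add: charts_at_def chart_on_atlas)

section \<open>Jacobians of coordinate changes\<close>

lemma transition_has_derivative:
  assumes "c \<in> charts_at A x" "d \<in> charts_at A x"
  shows "(transition c d has_derivative (*v) (jacobian (transition c d) (at (snd c x)))) (at (snd c x))"
proof -
  have "smooth_on (snd c ` (fst c \<inter> fst d)) (transition c d)"
    using manifold assms by (auto simp: smooth_manifold_def smooth_compatible_def charts_at_def)
  moreover have "snd c x \<in> snd c ` (fst c \<inter> fst d)"
    using assms by (auto simp: charts_at_def)
  ultimately show ?thesis
    using smooth_on_has_derivative differentiableI jacobian_works by blast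
qed

text \<open>The derivative depends only on values near \<open>snd c x\<close>, so any
  \<open>F\<close> that agrees there with the transition map yields its Jacobian. The chart
  \<open>d\<close> narrows the neighbourhood, as a composition through \<open>d\<close> is
  meaningful only over \<open>fst d\<close>.\<close>

lemma jacobian_transition_eqI:
  assumes "c \<in> charts_at A x" "d \<in> charts_at A x" "e \<in> charts_at A x"
    and "(F has_derivative (*v) M) (at (snd c x))"
    and "\<And>y. y \<in> fst c \<inter> fst d \<Longrightarrow> F (snd c y) = snd e y"
  shows "jacobian (transition c e) (at (snd c x)) = M"
proof -
  have "(transition c e has_derivative (*v) M) (at (snd c x))"
  proof (rule has_derivative_transform_within_open[OF assms(4)])
    show "open (snd c ` (fst c \<inter> fst d))"
      using open_chart_image[OF chart_on_charts_at[OF assms(1)]] chart_on_charts_at[OF assms(2)]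
      unfolding chart_on_def by blast
    show "snd c x \<in> snd c ` (fst c \<inter> fst d)"
      using assms(1,2) by (auto simp: charts_at_def)
    show "F z = transition c e z" if "z \<in> snd c ` (fst c \<inter> fst d)" for z
      using that assms(5) chart_inv_apply[OF chart_on_charts_at[OF assms(1)]]
      by (auto simp: transition_def)
  qed
  then have "(*v) (jacobian (transition c e) (at (snd c x))) = (*v) M"
    using has_derivative_unique transition_has_derivative[OF assms(1,3)] by blast
  then show ?thesis by (simp add: matrix_eq fun_eq_iff)
qed

lemma jacobian_transition_self:
  "c \<in> charts_at A x \<Longrightarrow> jacobian (transition c c) (at (snd c x)) = mat 1"
  by (rule jacobian_transition_eqI[where F = "\<lambda>z. z" and d = c])
    (auto intro!: has_derivative_eq_rhs[OF has_derivative_ident] simp: fun_eq_iff)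

text \<open>The chain rule for a coordinate change that passes through the chart \<open>d\<close>.
  This cocycle rule makes \<open>tvec_of\<close> a tangent vector.\<close>

lemma jacobian_transition_trans:
  assumes "c \<in> charts_at A x" "d \<in> charts_at A x" "e \<in> charts_at A x"
  shows "jacobian (transition c e) (at (snd c x)) =
    jacobian (transition d e) (at (snd d x)) ** jacobian (transition c d) (at (snd c x))"
proof (rule jacobian_transition_eqI[OF assms])
  note inv = chart_inv_apply[OF chart_on_charts_at[OF assms(1)]]
    chart_inv_apply[OF chart_on_charts_at[OF assms(2)]]
  have "transition c d (snd c x) = snd d x"
    using assms inv by (simp add: transition_def charts_at_def)
  moreover have "(*v) (M ** N) = (\<lambda>w. M *v (N *v w))" for M N :: "real^'n^'n"
    by (simp add: fun_eq_iff matrix_vector_mul_assoc)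
  ultimately show "((\<lambda>z. transition d e (transition c d z)) has_derivative
    (*v) (jacobian (transition d e) (at (snd d x)) ** jacobian (transition c d) (at (snd c x))))
      (at (snd c x))"
    using has_derivative_compose[OF transition_has_derivative[OF assms(1,2)], of "transition d e"]
      transition_has_derivative[OF assms(2,3)]
    by simp
  show "transition d e (transition c d (snd c y)) = snd e y" if "y \<in> fst c \<inter> fst d" for y
    using that inv by (simp add: transition_def)
qed

section \<open>Components of tangent and cotangent vectors\<close>

lemma tvec_of_in_tangent_space:
  "c \<in> charts_at A x \<Longrightarrow> tvec_of A c x w \<in> tangent_space A x"
  by (rule tangent_spaceI)
    (simp_all add: tvec_of_def matrix_vector_mul_assoc flip: jacobian_transition_trans)

lemma tvec_of_apply: "c \<in> charts_at A x \<Longrightarrow> tvec_of A c x w c = w"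
  by (simp add: tvec_of_def jacobian_transition_self)

lemma tvec_of_component:
  assumes "c \<in> charts_at A x" "v \<in> tangent_space A x"
  shows "tvec_of A c x (v c) = v"
  using assms
  by (auto simp: tvec_of_def fun_eq_iff tangent_space_outside simp flip: tangent_space_transform)

text \<open>In a chart the pairing becomes the Euclidean inner product, by expanding the components
  of \<open>v\<close> in the standard basis.\<close>

lemma covec_apply:
  assumes c: "c \<in> charts_at A x" and p: "p \<in> cotangent_space A x" and v: "v \<in> tangent_space A x"
  shows "p v = covec_coords A c x p \<bullet> v c"
proof -
  let ?q = "\<lambda>w. p (tvec_of A c x w)"
  have lin: "linear ?q"
    using p tvec_of_in_tangent_space[OF c]
      linear_add[OF linear_tvec_of[of A c x]] linear_cmul[OF linear_tvec_of[of A c x]]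
    by (simp add: linear_iff cotangent_space_def)
  have "?q (v c) = ?q (\<Sum>i\<in>UNIV. v c $ i *\<^sub>R axis i 1)"
    by (simp add: basis_expansion flip: scalar_mult_eq_scaleR)
  also have "\<dots> = covec_coords A c x p \<bullet> v c"
    by (simp add: linear_sum[OF lin] linear_cmul[OF lin] inner_vec_def covec_coords_def mult.commute)
  finally show ?thesis by (simp add: tvec_of_component[OF c v])
qed

subsection \<open>The graph matrix of a Lagrangian subspace\<close>

context
  fixes x :: 'a and L :: "(('a, 'n) tvec \<times> ('a, 'n) covec) set"
  assumes lagrangian: "lagrangian_subspace A x L"
    and projects: "fst ` L = tangent_space A x"
begin

text \<open>Two elements with the same tangent component differ by a vertical element
  \<open>(0, p)\<close> of \<open>L\<close>. Isotropy makes \<open>p\<close> vanish on the tangent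
  parts of \<open>L\<close>, which fill the tangent space.\<close>

lemma inj_on_lagrangian_component:
  assumes c: "c \<in> charts_at A x"
  shows "inj_on (\<lambda>q. fst q c) L"
proof (rule inj_onI)
  fix q q' assume q: "q \<in> L" "q' \<in> L" "fst q c = fst q' c"
  have "fst q \<in> tangent_space A x" "fst q' \<in> tangent_space A x"
    using q projects by auto
  then have fst: "fst q = fst q'"
    using tvec_of_component[OF c] q(3) by metis
  have sub: "L \<subseteq> whitney_fiber A x"
    using lagrangian by (simp add: lagrangian_subspace_def)
  let ?d = "q - q'"
  have d: "?d \<in> L"
    using q lagrangian subspace_diff unfolding lagrangian_subspace_def by blast
  \<comment> \<open>This removes the term of the canonical form in which a covector is evaluated at
    the zero tangent part of \<open>?d\<close>.\<close>
  have zero: "p 0 = 0" if "p \<in> cotangent_space A x" for p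
    using covec_apply[OF c that, of 0] subspace_0[OF subspace_tangent_space, of A x] by simp
  have "snd ?d v = 0" for v
  proof (cases "v \<in> tangent_space A x")
    case True
    then obtain w where w: "w \<in> L" "fst w = v" using projects by force
    have "canonical_form ?d w = 0"
      using d w(1) lagrangian unfolding lagrangian_subspace_def by blast
    moreover have "snd w 0 = 0"
      using w(1) sub by (intro zero) (auto simp: whitney_fiber_def)
    moreover have "fst ?d = 0" using fst by simp
    ultimately show ?thesis
      using w(2) by (simp add: canonical_form_def del: fst_diff snd_diff)
  next
    case False
    \<comment> \<open>Covectors are zero off the tangent space by convention, so
      \<open>snd ?d\<close> vanishes as a function on the whole type.\<close>
    have "snd ?d \<in> cotangent_space A x"
      using subsetD[OF sub d] by (simp only: whitney_fiber_def mem_Times_iff)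
    then show ?thesis using False by (simp add: cotangent_space_def del: snd_diff)
  qed
  then have "snd q = snd q'" by (simp add: fun_eq_iff)
  then show "q = q'" using fst by (simp add: prod_eq_iff)
qed

lemma lagrangian_component_image:
  assumes c: "c \<in> charts_at A x"
  shows "(\<lambda>q. fst q c) ` L = UNIV"
proof -
  have "w \<in> (\<lambda>q. fst q c) ` L" for w
  proof -
    have "tvec_of A c x w \<in> fst ` L"
      using tvec_of_in_tangent_space[OF c] projects by simp
    then obtain q where "q \<in> L" "fst q = tvec_of A c x w" by auto
    then have "q \<in> L" "w = fst q c" by (simp_all add: tvec_of_apply[OF c])
    then show ?thesis by blast
  qed
  then show ?thesis by blast
qed

text \<open>The chart component is a linear bijection from \<open>L\<close> onto the coordinate
  space. Following its inverse by the covector coordinates gives the linear map with matrix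
  \<open>P\<close>. Isotropy of \<open>L\<close> is the symmetry of \<open>P\<close>, and a graph
  determines its matrix.\<close>

lemma lagrangian_graph_ex1:
  assumes c: "c \<in> charts_at A x"
  shows "\<exists>!P. transpose P = P \<and> fiber_coords A c x ` L = {(\<delta>x, p). p = P *v \<delta>x}"
proof -
  have "subspace L" using lagrangian by (simp add: lagrangian_subspace_def)
  \<comment> \<open>The section \<open>s\<close> is a linear left inverse of the chart component on
    \<open>L\<close>, with values in \<open>L\<close>.\<close>
  then obtain s :: "real^'n \<Rightarrow> ('a, 'n) tvec \<times> ('a, 'n) covec"
    where s: "range s \<subseteq> L" "linear s" "\<forall>q\<in>L. s (fst q c) = q"
    using linear_exists_left_inverse_on[OF linear_fst_component _ inj_on_lagrangian_component[OF c]]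
    by blast
  have sL: "s w \<in> L" for w using s(1) by blast
  have s1: "fst (s w) c = w" for w
    using lagrangian_component_image[OF c] s(3) by (metis (no_types, lifting) UNIV_I imageE)
  let ?k = "\<lambda>w. snd (fiber_coords A c x (s w))"
  define P where "P = matrix ?k"
  have "linear ?k"
    using linear_compose[OF linear_compose[OF s(2) linear_fiber_coords] linear_snd]
    by (simp add: o_def)
  then have P: "P *v w = ?k w" for w
    by (simp add: P_def matrix_works)
  have fc: "fiber_coords A c x (s w) = (w, P *v w)" for w
    by (simp add: P prod_eq_iff) (simp add: fiber_coords_def s1)
  have graph: "fiber_coords A c x ` L = {(\<delta>x, p). p = P *v \<delta>x}"
  proof -
    have "fiber_coords A c x q = (fst q c, P *v fst q c)" if "q \<in> L" for q
      using fc s(3) that by metis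
    moreover have "(w, P *v w) \<in> fiber_coords A c x ` L" for w
      using fc sL by (metis image_eqI)
    ultimately show ?thesis by auto
  qed
  have sym: "(P *v a) \<bullet> b = (P *v b) \<bullet> a" for a b
  proof -
    \<comment> \<open>In coordinates the canonical form of \<open>s a\<close> and \<open>s b\<close>
      is the difference of the two sides.\<close>
    have "canonical_form (s a) (s b) = 0"
      using sL lagrangian unfolding lagrangian_subspace_def by blast
    moreover have "snd (s w') (fst (s w)) = (P *v w') \<bullet> w" for w w'
    proof -
      have mem: "snd (s w') \<in> cotangent_space A x" "fst (s w) \<in> tangent_space A x"
        using sL lagrangian projects
        by (auto simp: lagrangian_subspace_def whitney_fiber_def subset_iff mem_Times_iff)
      then show ?thesis
        using covec_apply[OF c mem] fc[of w'] s1 by (simp add: fiber_coords_def)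
    qed
    ultimately show ?thesis by (simp add: canonical_form_def)
  qed
  have "transpose P = P"
  proof -
    have "P $ i $ j = P $ j $ i" for i j
      using sym[of "axis j 1" "axis i 1"]
      by (simp add: inner_axis matrix_vector_mult_basis column_def)
    then show ?thesis by (simp add: transpose_def vec_eq_iff)
  qed
  moreover have "Q = P" if "fiber_coords A c x ` L = {(\<delta>x, p). p = Q *v \<delta>x}" for Q
  proof -
    have "(w, P *v w) \<in> {(\<delta>x, p). p = Q *v \<delta>x}" for w
      using graph that by auto
    then show ?thesis by (simp add: matrix_eq)
  qed
  ultimately show ?thesis using graph by blast
qed

end

end

section \<open>Smoothness of the graph matrix\<close>

context
  fixes X :: "'a topology" and A :: "('a, 'n::finite) chart set"
    and K :: "'a \<Rightarrow> (('a, 'n) tvec \<times> ('a, 'n) covec) set" and c :: "('a, 'n) chart"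
  assumes manifold: "smooth_manifold X A"
    and lagrangian: "lagrangian_subbundle X A K"
    and projects: "\<And>x. x \<in> topspace X \<Longrightarrow> fst ` K x = tangent_space A x"
    and chart: "c \<in> A"
begin

lemma chart_inv_in_chart:
  assumes "z \<in> snd c ` fst c"
  shows "chart_inv c z \<in> fst c" "snd c (chart_inv c z) = z"
  using assms by (auto simp: chart_inv_def inv_into_into f_inv_into_f)

lemma chart_subset_topspace: "fst c \<subseteq> topspace X"
  using chart_on_atlas[OF manifold chart] openin_subset by (auto simp: chart_on_def)

lemma charts_at_chart: "x \<in> fst c \<Longrightarrow> c \<in> charts_at A x"
  using chart by (simp add: charts_at_def)

lemma lagrangian_fiber: "x \<in> fst c \<Longrightarrow> lagrangian_subspace A x (K x)"
  using lagrangian chart_subset_topspace by (auto simp: lagrangian_subbundle_def)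

lemma projects_fiber: "x \<in> fst c \<Longrightarrow> fst ` K x = tangent_space A x"
  using projects chart_subset_topspace by auto

text \<open>Unique existence of the matrix justifies the definite description in
  \<open>graph_matrix\<close>.\<close>

lemma fiber_coords_image:
  assumes "z \<in> snd c ` fst c"
  shows "fiber_coords A c (chart_inv c z) ` K (chart_inv c z)
    = {(\<delta>x, p). p = graph_matrix A K c z *v \<delta>x}"
  using theI'[OF lagrangian_graph_ex1[OF manifold lagrangian_fiber projects_fiber charts_at_chart]]
    chart_inv_in_chart(1)[OF assms]
  unfolding graph_matrix_def by blast

text \<open>This brings the submanifold over a chart into the form required by
  \<open>tangent_vectors_graph\<close>.\<close>

lemma induced_coords_image:
  "induced_coords A c ` {y \<in> assoc_submanifold X K. fst y \<in> fst c}
    = {(z, \<delta>x, p). z \<in> snd c ` fst c \<and> p = graph_matrix A K c z *v \<delta>x}" (is "?L = ?R")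
proof (intro equalityI subsetI)
  fix y assume "y \<in> ?L"
  then obtain x q where x: "x \<in> fst c" and q: "q \<in> K x" and y: "y = (snd c x, fiber_coords A c x q)"
    by (auto simp: assoc_submanifold_def induced_coords_def)
  have inv: "chart_inv c (snd c x) = x"
    by (rule chart_inv_apply[OF chart_on_atlas[OF manifold chart] x])
  have "fiber_coords A c x q \<in> {(\<delta>x, p). p = graph_matrix A K c (snd c x) *v \<delta>x}"
    using imageI[OF q, of "fiber_coords A c x"] fiber_coords_image[of "snd c x"] x inv by simp
  then show "y \<in> ?R"
    using x y by auto
next
  fix y assume "y \<in> ?R"
  then obtain z a where z: "z \<in> snd c ` fst c" and y: "y = (z, a, graph_matrix A K c z *v a)"
    by auto
  let ?x = "chart_inv c z"
  have "(a, graph_matrix A K c z *v a) \<in> fiber_coords A c ?x ` K ?x"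
    using fiber_coords_image[OF z] by simp
  then obtain q where q: "q \<in> K ?x" "fiber_coords A c ?x q = (a, graph_matrix A K c z *v a)"
    by (metis imageE)
  have "y = induced_coords A c (?x, q)"
    using q y chart_inv_in_chart[OF z] by (simp add: induced_coords_def)
  moreover have "(?x, q) \<in> {y \<in> assoc_submanifold X K. fst y \<in> fst c}"
    using q chart_inv_in_chart[OF z] chart_subset_topspace by (auto simp: assoc_submanifold_def)
  ultimately show "y \<in> ?L" by blast
qed

text \<open>In coordinates a local frame of \<open>K\<close> consists of pairs whose covector part
  is the graph matrix applied to the tangent part. The tangent parts span, so the Cramer argument
  applies near each point, and smoothness is local.\<close>

lemma smooth_graph_matrix: "smooth_on (snd c ` fst c) (graph_matrix A K c)"
proof -
  have "\<exists>V. open V \<and> z0 \<in> V \<and> smooth_on V (graph_matrix A K c)" if z0: "z0 \<in> snd c ` fst c" for z0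
  proof -
    let ?x0 = "chart_inv c z0"
    have "?x0 \<in> topspace X" using chart_inv_in_chart(1)[OF z0] chart_subset_topspace by auto
    then obtain r :: nat and W s where W: "openin X W" "?x0 \<in> W"
      and sec: "\<And>i. i < r \<Longrightarrow> smooth_local_section A W (s i)"
      and basis: "\<And>x. x \<in> W \<Longrightarrow> inj_on (\<lambda>i. s i x) {..<r} \<and>
               independent ((\<lambda>i. s i x) ` {..<r}) \<and> span ((\<lambda>i. s i x) ` {..<r}) = K x"
      using lagrangian unfolding lagrangian_subbundle_def smooth_subbundle_def by metis
    define V where "V = snd c ` (fst c \<inter> W)"
    have V: "open V"
      unfolding V_def by (rule open_chart_image[OF chart_on_atlas[OF manifold chart] W(1)])
    have z0V: "z0 \<in> V"
      using W(2) chart_inv_in_chart[OF z0] unfolding V_def by (metis IntI image_eqI)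
    have x: "chart_inv c z \<in> fst c" "chart_inv c z \<in> W" "z \<in> snd c ` fst c" if "z \<in> V" for z
      using that chart_inv_apply[OF chart_on_atlas[OF manifold chart]] by (auto simp: V_def)
    define q where "q i z = fiber_coords A c (chart_inv c z) (s i (chart_inv c z))" for i z
    have q: "smooth_on V (q i)" if "i < r" for i
      using sec[OF that] chart unfolding smooth_local_section_def V_def q_def by blast
    have graph: "snd (q i z) = graph_matrix A K c z *v fst (q i z)" if "i < r" "z \<in> V" for i z
    proof -
      have "s i (chart_inv c z) \<in> K (chart_inv c z)"
        unfolding conjunct2[OF conjunct2[OF basis[OF x(2)[OF that(2)]]], symmetric]
        using that(1) by (auto intro!: span_base)
      then have "q i z \<in> {(\<delta>x, p). p = graph_matrix A K c z *v \<delta>x}"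
        using fiber_coords_image[OF x(3)[OF that(2)]] unfolding q_def by (metis imageI)
      then show ?thesis by auto
    qed
    \<comment> \<open>The chart component is an isomorphism from the fiber onto the coordinate
      space, so it carries the frame to a basis. This fixes the rank \<open>r\<close>, which the
      definition of a subbundle leaves open.\<close>
    have frame: "span ((\<lambda>i. fst (q i z)) ` {..<r}) = UNIV \<and> r = CARD('n)" if "z \<in> V" for z
    proof -
      let ?x = "chart_inv c z" and ?\<phi> = "\<lambda>y :: ('a, 'n) tvec \<times> ('a, 'n) covec. fst y c"
      let ?B = "(\<lambda>i. s i ?x) ` {..<r}"
      note fib = lagrangian_fiber[OF x(1)[OF that]] projects_fiber[OF x(1)[OF that]]
        charts_at_chart[OF x(1)[OF that]]
      have B: "inj_on (\<lambda>i. s i ?x) {..<r}" "independent ?B" "span ?B = K ?x"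
        using basis[OF x(2)[OF that]] by auto
      have inj: "inj_on ?\<phi> (span ?B)"
        unfolding B(3) by (rule inj_on_lagrangian_component[OF manifold fib])
      have ind: "independent (?\<phi> ` ?B)"
        by (rule linear_independent_injective_image[OF linear_fst_component B(2) inj])
      have span: "span (?\<phi> ` ?B) = UNIV"
        using linear_span_image[OF linear_fst_component, of c ?B]
          lagrangian_component_image[OF manifold fib] B(3) by simp
      have "card (?\<phi> ` ?B) = r"
        using B(1) inj_on_subset[OF inj span_superset] by (simp add: card_image)
      moreover have "card (?\<phi> ` ?B) = CARD('n)"
        using dim_eq_card_independent[OF ind] dim_span[of "?\<phi> ` ?B"] span by simp
      moreover have "?\<phi> ` ?B = (\<lambda>i. fst (q i z)) ` {..<r}"
        by (auto simp: q_def fiber_coords_def image_image)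
      ultimately show ?thesis using span by simp
    qed
    have "r = CARD('n)" using frame z0V by blast
    \<comment> \<open>The frame is reindexed by the coordinate type \<open>'n\<close>, so that the
      linear system for Cramer's rule becomes a square matrix.\<close>
    then have "\<exists>e. bij_betw e (UNIV :: 'n set) {..<r}"
      by (intro finite_same_card_bij) simp_all
    then obtain e :: "'n \<Rightarrow> nat" where e: "bij_betw e UNIV {..<r}"
      by blast
    have er: "e b < r" for b
      using bij_betwE[OF e] by simp
    have "smooth_on V (graph_matrix A K c)"
    proof (rule smooth_on_matrix_if_maps_spanning_sections[OF V])
      show "smooth_on V (\<lambda>z. fst (q (e b) z))" "smooth_on V (\<lambda>z. snd (q (e b) z))" for b
        using smooth_on_fst_snd[OF V q[OF er]] by auto
      show "snd (q (e b) z) = graph_matrix A K c z *v fst (q (e b) z)" if "z \<in> V" for z b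
        by (rule graph[OF er that])
      show "span (range (\<lambda>b. fst (q (e b) z))) = UNIV" if "z \<in> V" for z
      proof -
        have "range (\<lambda>b. fst (q (e b) z)) = (\<lambda>i. fst (q i z)) ` {..<r}"
          unfolding bij_betw_imp_surj_on[OF e, symmetric] by (simp add: image_image)
        then show ?thesis using frame[OF that] by metis
      qed
    qed
    then show ?thesis using V z0V by blast
  qed
  then show ?thesis
    unfolding smooth_on_def by (intro allI Ck_on_local) blast
qed

end

section \<open>Invariance\<close>

text \<open>Moving a point of \<open>U\<close> along axis \<open>j\<close> changes the affine
  expression by a multiple of \<open>M j\<close> alone. Once all \<open>M j\<close> are zero, only
  \<open>M0\<close> remains.\<close>

lemma affine_vanishes_on_open:
  fixes M :: "'m::finite \<Rightarrow> 'b::real_normed_vector"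
  assumes "open U" "U \<noteq> {}" "\<And>u :: real^'m. u \<in> U \<Longrightarrow> M0 + (\<Sum>j\<in>UNIV. u $ j *\<^sub>R M j) = 0"
  shows "M0 = 0 \<and> (\<forall>j. M j = 0)"
proof -
  obtain u0 where u0: "u0 \<in> U" using assms(2) by blast
  \<comment> \<open>A closed ball, since the shifted point lies at distance exactly
    \<open>\<epsilon>\<close>.\<close>
  then obtain \<epsilon> where eps: "\<epsilon> > 0" "cball u0 \<epsilon> \<subseteq> U"
    using assms(1) open_contains_cball by blast
  have Mj: "M j = 0" for j
  proof -
    let ?u = "u0 + \<epsilon> *\<^sub>R axis j 1"
    have "?u \<in> U" using eps by (intro subsetD[OF eps(2)]) (simp add: dist_norm)
    then have "(\<Sum>i\<in>UNIV. ?u $ i *\<^sub>R M i) = (\<Sum>i\<in>UNIV. u0 $ i *\<^sub>R M i)"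
      using assms(3)[OF u0] assms(3)[of ?u] by (metis add_left_cancel)
    moreover have "(\<Sum>i\<in>UNIV. ?u $ i *\<^sub>R M i) = (\<Sum>i\<in>UNIV. u0 $ i *\<^sub>R M i) + \<epsilon> *\<^sub>R M j"
      by (simp add: scaleR_add_left sum.distrib axis_def if_distrib[where f = "\<lambda>r. r *\<^sub>R _"]
          if_distrib[where f = "\<lambda>r. _ * r"] cong: if_cong)
    ultimately show ?thesis using eps(1) by simp
  qed
  then show ?thesis using assms(3)[OF u0] by simp
qed

text \<open>The graph criterion is applied to the components of the right-hand side. The derivative
  of \<open>P\<close> is linear in the direction, so the drift and each input contribute separately.
  Every term ends in \<open>d\<close>, and moving all of them to one side gives the matrix.\<close>

lemma diff_hamiltonian_rhs_tangent_iff: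
  fixes P :: "real^'n::finite \<Rightarrow> real^'n^'n" and c :: "('a, 'n) chart"
    and f :: "'a \<Rightarrow> ('a, 'n) tvec" and g :: "'m::finite \<Rightarrow> 'a \<Rightarrow> ('a, 'n) tvec"
    and h :: "'m \<Rightarrow> 'a \<Rightarrow> real"
  assumes "open V" "smooth_on V P" "z \<in> V"
  defines "Df \<equiv> jacobian (vf_rep c f) (at z)" and "gm \<equiv> input_matrix_rep c g z"
    and "Dh \<equiv> jacobian (output_rep c h) (at z)" and "Dg \<equiv> \<lambda>j. jacobian (vf_rep c (g j)) (at z)"
  shows "diff_hamiltonian_rhs c f g h u (z, d, P z *v d)
      \<in> tangent_vectors {(y, d, p). y \<in> V \<and> p = P y *v d} (z, d, P z *v d) \<longleftrightarrow>
    (transpose Df ** P z + P z ** Df - P z ** gm ** transpose gm ** P z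
            + transpose Dh ** Dh + matrix_derivative_along P z (vf_rep c f z)
      + (\<Sum>j\<in>UNIV. u $ j *\<^sub>R (transpose (Dg j) ** P z + P z ** Dg j
          + matrix_derivative_along P z (vf_rep c (g j) z)))) *v d = 0"
proof -
  have P': "(P has_derivative frechet_derivative P (at z)) (at z)"
    using assms smooth_on_has_derivative by blast
  then have lin: "linear (frechet_derivative P (at z))"
    by (rule has_derivative_linear)
  have sum_mult: "(\<Sum>j\<in>UNIV. M j) *v w = (\<Sum>j\<in>UNIV. M j *v w)"
    and mult_sum: "N *v (\<Sum>j\<in>UNIV. v j) = (\<Sum>j\<in>UNIV. N *v v j)"
    for M :: "'m \<Rightarrow> real^'n^'n" and w N and v :: "'m \<Rightarrow> real^'n"
    using bounded_bilinear.sum_left[OF bounded_bilinear_matrix_vector_mult, of M UNIV w]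
      bounded_bilinear.sum_right[OF bounded_bilinear_matrix_vector_mult, of N v UNIV] by auto
  show ?thesis
    unfolding diff_hamiltonian_rhs_def Let_def prod.case tangent_vectors_graph[OF assms(1-3)]
      matrix_derivative_along_eq[OF P'] Df_def gm_def Dh_def Dg_def
    by (simp add: linear_add[OF lin] linear_sum[OF lin] linear_cmul[OF lin]
        matrix_vector_mult_add_rdistrib matrix_vector_mult_diff_rdistrib matrix_vector_right_distrib
        matrix_vector_mult_diff_distrib sum_mult mult_sum matrix_vector_mult_scaleR
        scaleR_matrix_vector_assoc[symmetric] sum.distrib scaleR_add_right
        matrix_vector_mul_assoc matrix_mul_assoc) (auto simp: algebra_simps eq_neg_iff_add_eq_0)
qed

theorem mainTheorem3:
  fixes X :: "'a topology" and A :: "('a, 'n::finite) chart set"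
    and f :: "'a \<Rightarrow> ('a, 'n) tvec" and g :: "'m::finite \<Rightarrow> 'a \<Rightarrow> ('a, 'n) tvec"
    and h :: "'m \<Rightarrow> 'a \<Rightarrow> real" and U :: "(real^'m) set"
    and K :: "'a \<Rightarrow> (('a, 'n) tvec \<times> ('a, 'n) covec) set"
  assumes "smooth_manifold X A"
    and "smooth_vector_field X A f"
    and "\<And>j. smooth_vector_field X A (g j)"
    and "\<And>j. smooth_function A (h j)"
    and "open U" and "U \<noteq> {}"
    and "lagrangian_subbundle X A K"
    and "\<And>x. x \<in> topspace X \<Longrightarrow> fst ` K x = tangent_space A x"
  shows "invariant_subbundle X A f g h U K \<longleftrightarrow>
    (\<forall>c\<in>A. \<forall>z \<in> snd c ` fst c.
       let P = graph_matrix A K c; Df = jacobian (vf_rep c f) (at z);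
           gm = input_matrix_rep c g z; Dh = jacobian (output_rep c h) (at z)
       in transpose Df ** P z + P z ** Df - P z ** gm ** transpose gm ** P z
            + transpose Dh ** Dh + matrix_derivative_along P z (vf_rep c f z) = 0 \<and>
          (\<forall>j. let Dg = jacobian (vf_rep c (g j)) (at z)
                in transpose Dg ** P z + P z ** Dg
                     + matrix_derivative_along P z (vf_rep c (g j) z) = 0))"
proof -
  let ?S = "\<lambda>c. induced_coords A c ` {y \<in> assoc_submanifold X K. fst y \<in> fst c}"
  let ?Ric = "\<lambda>c z. let P = graph_matrix A K c; Df = jacobian (vf_rep c f) (at z);
           gm = input_matrix_rep c g z; Dh = jacobian (output_rep c h) (at z)
       in transpose Df ** P z + P z ** Df - P z ** gm ** transpose gm ** P z
            + transpose Dh ** Dh + matrix_derivative_along P z (vf_rep c f z)"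
  let ?M = "\<lambda>c z j. let P = graph_matrix A K c; Dg = jacobian (vf_rep c (g j)) (at z)
                in transpose Dg ** P z + P z ** Dg
                     + matrix_derivative_along P z (vf_rep c (g j) z)"
  \<comment> \<open>Choosing the chart before the point turns tangency into a condition on the image
    of the submanifold in each chart.\<close>
  have "invariant_subbundle X A f g h U K \<longleftrightarrow>
    (\<forall>u\<in>U. \<forall>c\<in>A. \<forall>y\<in>?S c. diff_hamiltonian_rhs c f g h u y \<in> tangent_vectors (?S c) y)"
    unfolding invariant_subbundle_def charts_at_def by fastforce
  also have "\<dots> \<longleftrightarrow> (\<forall>u\<in>U. \<forall>c\<in>A. \<forall>z\<in>snd c ` fst c. \<forall>d.
      (?Ric c z + (\<Sum>j\<in>UNIV. u $ j *\<^sub>R ?M c z j)) *v d = 0)"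
  proof (intro ball_cong refl)
    fix u c assume "u \<in> U" and c: "c \<in> A"
    let ?V = "snd c ` fst c" and ?P = "graph_matrix A K c"
    have V: "open ?V"
      using chart_on_atlas[OF assms(1) c] by (simp add: chart_on_def)
    have S: "?S c = {(z, d, p). z \<in> ?V \<and> p = ?P z *v d}"
      by (rule induced_coords_image[OF assms(1,7,8) c])
    have "(\<forall>y\<in>?S c. diff_hamiltonian_rhs c f g h u y \<in> tangent_vectors (?S c) y) \<longleftrightarrow>
      (\<forall>z\<in>?V. \<forall>d. diff_hamiltonian_rhs c f g h u (z, d, ?P z *v d) \<in>
        tangent_vectors {(z, d, p). z \<in> ?V \<and> p = ?P z *v d} (z, d, ?P z *v d))"
      unfolding S by blast
    also have "\<dots> \<longleftrightarrow> (\<forall>z\<in>?V. \<forall>d. (?Ric c z + (\<Sum>j\<in>UNIV. u $ j *\<^sub>R ?M c z j)) *v d = 0)"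
      using diff_hamiltonian_rhs_tangent_iff[OF V smooth_graph_matrix[OF assms(1,7,8) c]]
      unfolding Let_def by blast
    finally show "(\<forall>y\<in>?S c. diff_hamiltonian_rhs c f g h u y \<in> tangent_vectors (?S c) y) \<longleftrightarrow>
      (\<forall>z\<in>?V. \<forall>d. (?Ric c z + (\<Sum>j\<in>UNIV. u $ j *\<^sub>R ?M c z j)) *v d = 0)" .
  qed
  \<comment> \<open>A matrix that annihilates every \<open>d\<close> is zero. The input
    \<open>u\<close> becomes the innermost quantifier, so that the affine argument applies at each
    fixed point.\<close>
  also have "\<dots> \<longleftrightarrow> (\<forall>c\<in>A. \<forall>z\<in>snd c ` fst c. \<forall>u\<in>U.
      ?Ric c z + (\<Sum>j\<in>UNIV. u $ j *\<^sub>R ?M c z j) = 0)"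
    unfolding matrix_eq[of _ 0] matrix_vector_mult_0 by blast
  also have "\<dots> \<longleftrightarrow> (\<forall>c\<in>A. \<forall>z\<in>snd c ` fst c. ?Ric c z = 0 \<and> (\<forall>j. ?M c z j = 0))"
  proof (intro ball_cong refl)
    fix c z
    show "(\<forall>u\<in>U. ?Ric c z + (\<Sum>j\<in>UNIV. u $ j *\<^sub>R ?M c z j) = 0)
      \<longleftrightarrow> ?Ric c z = 0 \<and> (\<forall>j. ?M c z j = 0)"
      using affine_vanishes_on_open[OF assms(5,6), of "?Ric c z" "?M c z"]
      by (auto simp del: Let_def)
  qed
  finally show ?thesis unfolding Let_def .
qed

end
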